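(* Problem EE, for ellipses $E_k=E(\boldsymbol a_k,\boldsymbol b_k)$, $k=0,\ldots,N$, is equivalent to the following optimisation problem: $$\left\{\begin{aligned}(\boldsymbol x,\boldsymbol a_0)^2+(\boldsymbol x,\boldsymbol b_0)^2\ &\to\ \max\\ (\boldsymbol x,\boldsymbol a_k)^2+(\boldsymbol x,\boldsymbol b_k)^2\ &\le\ 1,\qquad k=1,\ldots,N,\end{aligned}\right.$$ with $d$ variables $(x_1,\ldots,x_d)^T=\boldsymbol x$ and given vectors $\boldsymbol a_k,\boldsymbol b_k\in\mathbb R^d$.
   Context: For $\boldsymbol a,\boldsymbol b\in\mathbb R^d$, $E(\boldsymbol a,\boldsymbol b)=\{\boldsymbol a\cos t+\boldsymbol b\sin t : t\in\mathbb R\}$ is the (possibly degenerate) two-dimensional ellipse centred at the origin with conjugate radii $\boldsymbol a,\boldsymbol b$. $\mathrm{co}$ denotes the convex hull of the union of the listed sets, and $(\cdot,\cdot)$ is the standard scalar product on $\mathbb R^d$. Problem EE: for given ellipses $E_0,\ldots,E_N$ in $\mathbb R^d$ of this form, decide whether $E_0\subset\mathrm{co}\{E_1,\ldots,E_N\}$. *)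

theory Defs
  imports "HOL-Analysis.Analysis"
begin

definition ellipse :: "real ^ 'd \<Rightarrow> real ^ 'd \<Rightarrow> (real ^ 'd) set" where
  "ellipse a b = {cos t *\<^sub>R a + sin t *\<^sub>R b | t. True}"

definition problem_EE :: "nat \<Rightarrow> (nat \<Rightarrow> real ^ 'd) \<Rightarrow> (nat \<Rightarrow> real ^ 'd) \<Rightarrow> bool" where
  "problem_EE N a b \<longleftrightarrow>
     ellipse (a 0) (b 0) \<subseteq> convex hull (\<Union>k\<in>{1..N}. ellipse (a k) (b k))"

definition EE_objective :: "(nat \<Rightarrow> real ^ 'd) \<Rightarrow> (nat \<Rightarrow> real ^ 'd) \<Rightarrow> real ^ 'd \<Rightarrow> real" where
  "EE_objective a b x = (x \<bullet> a 0)\<^sup>2 + (x \<bullet> b 0)\<^sup>2"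

definition EE_feasible :: "nat \<Rightarrow> (nat \<Rightarrow> real ^ 'd) \<Rightarrow> (nat \<Rightarrow> real ^ 'd) \<Rightarrow> (real ^ 'd) set" where
  "EE_feasible N a b = {x. \<forall>k\<in>{1..N}. (x \<bullet> a k)\<^sup>2 + (x \<bullet> b k)\<^sup>2 \<le> 1}"

(* The supremum is taken in the extended reals: if the ellipses with index 1, ..., N do not
   span the space, the feasible set is unbounded and the value may be infinite. *)
definition EE_value :: "nat \<Rightarrow> (nat \<Rightarrow> real ^ 'd) \<Rightarrow> (nat \<Rightarrow> real ^ 'd) \<Rightarrow> ereal" where
  "EE_value N a b = (SUP x\<in>EE_feasible N a b. ereal (EE_objective a b x))"

end

theory Submission
  imports Defs
begin

text \<open>The support function of \<open>ellipse a b\<close> in direction \<open>x\<close> is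
  \<open>sqrt ((x \<bullet> a)\<^sup>2 + (x \<bullet> b)\<^sup>2)\<close>. Hence the feasible set is the polar of the hull of the
  ellipses with positive index, and the value is at most 1 iff this polar is contained in the polar
  of \<open>E\<^sub>0\<close>. As the hull is compact, convex and contains 0, the bipolar theorem (a separating
  hyperplane argument) turns this into the inclusion of the sets themselves.\<close>

text \<open>Forwards, a point of the ellipse attains the support value \<open>s\<close>, so the
  bound there gives \<open>s \<le> 1\<close>; backwards, completing a square avoids the
  root.\<close>

lemma ellipse_polar_iff:
  "(\<forall>p\<in>ellipse a b. x \<bullet> p \<le> 1) \<longleftrightarrow> (x \<bullet> a)\<^sup>2 + (x \<bullet> b)\<^sup>2 \<le> 1"
proof
  define s where "s = sqrt ((x \<bullet> a)\<^sup>2 + (x \<bullet> b)\<^sup>2)"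
  have s2: "s\<^sup>2 = (x \<bullet> a)\<^sup>2 + (x \<bullet> b)\<^sup>2" and s0: "s \<ge> 0"
    by (simp_all add: s_def)
  assume *: "\<forall>p\<in>ellipse a b. x \<bullet> p \<le> 1"
  show "(x \<bullet> a)\<^sup>2 + (x \<bullet> b)\<^sup>2 \<le> 1"
  proof (cases "s = 0")
    case False
    then have "((x \<bullet> a) / s)\<^sup>2 + ((x \<bullet> b) / s)\<^sup>2 = 1"
      using s2 by (metis add_divide_distrib divide_self power_divide power_not_zero)
    \<comment> \<open>\<open>t\<close> is the polar angle of the plane vector with coordinates
      \<open>x \<bullet> a\<close> and \<open>x \<bullet> b\<close>; at this parameter
      \<open>x \<bullet> p\<close> reaches its maximum \<open>s\<close>.\<close>
    then obtain t where t: "(x \<bullet> a) / s = cos t" "(x \<bullet> b) / s = sin t"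
      using sincos_total_2pi by blast
    have "s = x \<bullet> (cos t *\<^sub>R a + sin t *\<^sub>R b)"
      using s2 False by (simp add: inner_right_distrib field_simps power2_eq_square flip: t)
    also have "\<dots> \<le> 1"
      using * by (auto simp: ellipse_def)
    finally show ?thesis
      using s0 by (simp add: power_le_one flip: s2)
  qed (use s2 in simp)
next
  assume *: "(x \<bullet> a)\<^sup>2 + (x \<bullet> b)\<^sup>2 \<le> 1"
  show "\<forall>p\<in>ellipse a b. x \<bullet> p \<le> 1"
  proof
    fix p assume "p \<in> ellipse a b"
    then obtain t where p: "p = cos t *\<^sub>R a + sin t *\<^sub>R b"
      by (auto simp: ellipse_def)
    \<comment> \<open>Expanding this squared distance to a point of the unit circle yields
      \<open>2 * (x \<bullet> p) \<le> 1 + 1\<close>.\<close>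
    have "0 \<le> (x \<bullet> a - cos t)\<^sup>2 + (x \<bullet> b - sin t)\<^sup>2"
      by simp
    also have "\<dots> = (x \<bullet> a)\<^sup>2 + (x \<bullet> b)\<^sup>2 + ((sin t)\<^sup>2 + (cos t)\<^sup>2) - 2 * (x \<bullet> p)"
      by (simp add: p power2_diff inner_right_distrib del: sin_cos_squared_add)
    finally show "x \<bullet> p \<le> 1"
      using * by simp
  qed
qed

text \<open>By periodicity one period of the parameter suffices. Compactness passes to the hull of
  finitely many ellipses, which is then closed, as the separation argument requires.\<close>

lemma compact_ellipse: "compact (ellipse a b)"
proof -
  have "ellipse a b = (\<lambda>t. cos t *\<^sub>R a + sin t *\<^sub>R b) ` {0..2 * pi}"
  proof (intro subset_antisym subsetI)
    fix p assume "p \<in> ellipse a b"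
    then obtain t where p: "p = cos t *\<^sub>R a + sin t *\<^sub>R b"
      by (auto simp: ellipse_def)
    obtain u where "0 \<le> u" "u \<le> 2 * pi" "cos t = cos u" "sin t = sin u"
      using sincos_total_2pi_le[of "cos t" "sin t"] by auto
    with p show "p \<in> (\<lambda>t. cos t *\<^sub>R a + sin t *\<^sub>R b) ` {0..2 * pi}"
      by auto
  qed (auto simp: ellipse_def)
  then show ?thesis
    by (auto intro!: compact_continuous_image continuous_intros)
qed

text \<open>The origin is the midpoint of the antipodal points at parameters \<open>0\<close> and
  \<open>pi\<close>. It later fixes the sign of the separating constant.\<close>

lemma zero_in_convex_hull_ellipse: "0 \<in> convex hull (ellipse a b)"
proof -
  have "a \<in> ellipse a b"
    unfolding ellipse_def by (auto intro!: exI[of _ 0])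
  moreover have "- a \<in> ellipse a b"
    unfolding ellipse_def by (auto intro!: exI[of _ pi])
  ultimately have "(1/2) *\<^sub>R a + (1/2) *\<^sub>R (- a) \<in> convex hull (ellipse a b)"
    by (intro convexD[OF convex_convex_hull]) (auto intro: hull_inc)
  then show ?thesis
    by simp
qed

lemma EE_value_le_1_iff:
  "EE_value N a b \<le> 1 \<longleftrightarrow> (\<forall>x\<in>EE_feasible N a b. EE_objective a b x \<le> 1)"
  by (simp add: EE_value_def SUP_le_iff)

theorem theorem3p1:
  fixes a b :: "nat \<Rightarrow> real ^ 'd" and N :: nat
  assumes "N \<ge> 1"
  shows "problem_EE N a b \<longleftrightarrow> EE_value N a b \<le> 1"
proof -
  define U where "U = (\<Union>k\<in>{1..N}. ellipse (a k) (b k))"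
  have feasible: "x \<in> EE_feasible N a b \<longleftrightarrow> (\<forall>q\<in>U. x \<bullet> q \<le> 1)" for x
    by (auto simp: EE_feasible_def U_def simp flip: ellipse_polar_iff)
  have objective: "EE_objective a b x \<le> 1 \<longleftrightarrow> (\<forall>p\<in>ellipse (a 0) (b 0). x \<bullet> p \<le> 1)" for x
    by (simp add: EE_objective_def ellipse_polar_iff)
  have "ellipse (a 0) (b 0) \<subseteq> convex hull U \<longleftrightarrow>
    (\<forall>x. (\<forall>q\<in>U. x \<bullet> q \<le> 1) \<longrightarrow> (\<forall>p\<in>ellipse (a 0) (b 0). x \<bullet> p \<le> 1))"
    (is "?lhs \<longleftrightarrow> ?rhs")
  proof
    assume ?lhs
    show ?rhs
    proof (intro allI impI)
      fix x assume "\<forall>q\<in>U. x \<bullet> q \<le> 1"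
      then have "convex hull U \<subseteq> {q. x \<bullet> q \<le> 1}"
        by (intro hull_minimal convex_halfspace_le) auto
      with \<open>?lhs\<close> show "\<forall>p\<in>ellipse (a 0) (b 0). x \<bullet> p \<le> 1"
        by blast
    qed
  next
    assume ?rhs
    show ?lhs
    proof (rule subsetI, rule ccontr)
      fix p assume p: "p \<in> ellipse (a 0) (b 0)" and notin: "p \<notin> convex hull U"
      have "compact (convex hull U)"
        unfolding U_def by (intro compact_convex_hull compact_UN compact_ellipse) auto
      then obtain x c where x: "x \<bullet> p < c" "\<And>q. q \<in> convex hull U \<Longrightarrow> c < x \<bullet> q"
        using separating_hyperplane_closed_point[OF convex_convex_hull _ notin]
          compact_imp_closed by blast
      \<comment> \<open>Here \<open>N \<ge> 1\<close> enters: for \<open>N = 0\<close> the hull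
        would be empty and miss the origin.\<close>
      have "ellipse (a 1) (b 1) \<subseteq> U"
        using assms by (auto simp: U_def)
      then have "0 \<in> convex hull U"
        using zero_in_convex_hull_ellipse hull_mono by blast
      with x(2) have c: "c < 0"
        by fastforce
      \<comment> \<open>Dividing by the negative \<open>c\<close> reverses both separation
        inequalities: the rescaled normal is at most 1 on \<open>U\<close>, yet exceeds 1 at
        \<open>p\<close>.\<close>
      have "(inverse c *\<^sub>R x) \<bullet> q \<le> 1" if "q \<in> U" for q
        using x(2)[OF hull_inc[OF that]] c by (simp add: field_simps)
      with \<open>?rhs\<close> p have "(inverse c *\<^sub>R x) \<bullet> p \<le> 1"
        by blast
      with x(1) c show False
        by (simp add: field_simps)
    qed
  qed
  then show ?thesis
    by (simp only: problem_EE_def EE_value_le_1_iff Ball_def feasible objective flip: U_def)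
qed

end
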